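(* Fix $0<r<1$. The collection $\mathscr{Q}\mathbb{A}_r$ has the following properties. (a) If $J\in \mathscr{Q}\mathbb{A}_r$, then $J$ belongs to $\mathbb{Q}\mathbb{A}_r$ and is dilation extremal in $\mathbb{Q}\mathbb{A}_r$. (b) If $J\in \mathscr{Q}\mathbb{A}_r$ acts on the Hilbert space $K$ and $\pi:B(K)\to B(G)$ is a unital $*$-representation on a Hilbert space $G$, then $\pi(J)\in \mathscr{Q}\mathbb{A}_r$ (acting on $G$). (c) If $T\in \mathbb{Q}\mathbb{A}_r$, then $T$ dilates to some $J\in \mathscr{Q}\mathbb{A}_r$.
   Context: For a (complex) Hilbert space $H$, $B(H)$ denotes the bounded operators on $H$. Fix $0<r<1$. The quantum annulus $\mathbb{Q}\mathbb{A}_r$ is the collection of all invertible Hilbert space operators $T$ satisfying $\|T\|\le r^{-1}$ and $\|T^{-1}\|\le r^{-1}$. $\mathscr{Q}\mathbb{A}_r$ is the collection of Hilbert space operators $J$ that, up to unitary equivalence, have the form $$J=U\begin{pmatrix} r I_{K_{+1}} & 0\\ 0 & r^{-1} I_{K_{-1}}\end{pmatrix},$$ acting on a Hilbert space direct sum $K_{+1}\oplus K_{-1}$, where $U$ is a unitary operator on $K_{+1}\oplus K_{-1}$ and $I_{K_{\pm1}}$ is the identity on $K_{\pm 1}$. Equivalently, $J$ is invertible and there exist orthogonal projections $P_+,P_-$ with $P_++P_-=I$ such that $J^*J=r^2P_++r^{-2}P_-$. An invertible operator $T\in B(H)$ dilates to an invertible operator $J\in B(K)$ if there is an isometry $V:H\to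 K$ such that $T^n=V^*J^nV$ for all integers $n$ (positive, zero and negative). This dilation is trivial if the range of $V$ reduces $J$ (i.e., is invariant for both $J$ and $J^*$). An operator $T\in\mathbb{Q}\mathbb{A}_r$ is dilation extremal in $\mathbb{Q}\mathbb{A}_r$ if all of its dilations to elements of $\mathbb{Q}\mathbb{A}_r$ are trivial; that is, whenever $J\in\mathbb{Q}\mathbb{A}_r$ and $V$ is an isometry with $T^n=V^*J^nV$ for all integers $n$, the range of $V$ reduces $J$. *)

theory Defs
  imports "HOL-Analysis.Analysis"
begin

text \<open>
  Complex Hilbert spaces as a type class. The norm, the topology and completeness come from the
  underlying real Hilbert space, whose inner product is the real part of the complex one.
  The complex inner product is linear in its first argument.
\<close>

class complex_hilbert = real_inner + complete_space +
  fixes scaleC :: "complex \<Rightarrow> 'a \<Rightarrow> 'a"  (infixr \<open>*\<^sub>C\<close> 75)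
    and cinner :: "'a \<Rightarrow> 'a \<Rightarrow> complex"
  assumes scaleC_add_right: "c *\<^sub>C (x + y) = c *\<^sub>C x + c *\<^sub>C y"
    and scaleC_add_left: "(c + d) *\<^sub>C x = c *\<^sub>C x + d *\<^sub>C x"
    and scaleC_scaleC: "c *\<^sub>C d *\<^sub>C x = (c * d) *\<^sub>C x"
    and scaleC_complex_of_real: "complex_of_real a *\<^sub>C x = a *\<^sub>R x"
    and cinner_commute: "cinner x y = cnj (cinner y x)"
    and cinner_add_left: "cinner (x + y) z = cinner x z + cinner y z"
    and cinner_scaleC_left: "cinner (c *\<^sub>C x) y = c * cinner x y"
    and Re_cinner: "Re (cinner x y) = inner x y"

lemma cinner_self: "cinner x x = complex_of_real ((norm x)\<^sup>2)"
  for x :: "'a::complex_hilbert"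
proof (rule complex_eqI)
  show "Re (cinner x x) = Re (complex_of_real ((norm x)\<^sup>2))"
    by (simp add: Re_cinner power2_norm_eq_inner)
  have "Im (cinner x x) = - Im (cinner x x)"
    using arg_cong[OF cinner_commute[of x x], of Im] by simp
  then show "Im (cinner x x) = Im (complex_of_real ((norm x)\<^sup>2))"
    by simp
qed

instantiation complex :: complex_hilbert
begin

definition scaleC_complex :: "complex \<Rightarrow> complex \<Rightarrow> complex"
  where "scaleC_complex c x = c * x"

definition cinner_complex :: "complex \<Rightarrow> complex \<Rightarrow> complex"
  where "cinner_complex x y = x * cnj y"

instance
  by standard
    (auto simp: scaleC_complex_def cinner_complex_def inner_complex_def scaleR_conv_of_real
      algebra_simps)

end

text \<open>The Hilbert space direct sum of two complex Hilbert spaces.\<close>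

instantiation prod :: (complex_hilbert, complex_hilbert) complex_hilbert
begin

definition scaleC_prod :: "complex \<Rightarrow> 'a \<times> 'b \<Rightarrow> 'a \<times> 'b"
  where "scaleC_prod c x = (c *\<^sub>C fst x, c *\<^sub>C snd x)"

definition cinner_prod :: "'a \<times> 'b \<Rightarrow> 'a \<times> 'b \<Rightarrow> complex"
  where "cinner_prod x y = cinner (fst x) (fst y) + cinner (snd x) (snd y)"

instance
proof
  fix x y :: "'a \<times> 'b"
  show "cinner x y = cnj (cinner y x)"
    unfolding cinner_prod_def complex_cnj_add
    by (simp flip: cinner_commute)
qed (auto simp: scaleC_prod_def cinner_prod_def inner_prod_def Re_cinner scaleC_add_right
      scaleC_add_left scaleC_scaleC scaleC_complex_of_real cinner_add_left cinner_scaleC_left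
      scaleR_prod_def algebra_simps)

end

definition bounded_clinear :: "('a::complex_hilbert \<Rightarrow> 'b::complex_hilbert) \<Rightarrow> bool"
  where "bounded_clinear A \<longleftrightarrow> bounded_linear A \<and> (\<forall>c x. A (c *\<^sub>C x) = c *\<^sub>C A x)"

text \<open>
  Meaningful for bounded operators only: for these such a function exists (Riesz), is unique, and is
  again a bounded operator.
\<close>

definition cadjoint :: "('a::complex_hilbert \<Rightarrow> 'b::complex_hilbert) \<Rightarrow> 'b \<Rightarrow> 'a"
  where "cadjoint A = (SOME B. \<forall>x y. cinner (A x) y = cinner x (B y))"

definition invertible_op :: "('a::complex_hilbert \<Rightarrow> 'a) \<Rightarrow> bool"
  where "invertible_op T \<longleftrightarrow>
    bounded_clinear T \<and> (\<exists>S. bounded_clinear S \<and> S \<circ> T = id \<and> T \<circ> S = id)"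

definition op_powi :: "('a \<Rightarrow> 'a) \<Rightarrow> int \<Rightarrow> 'a \<Rightarrow> 'a"
  where "op_powi T n = (if n \<ge> 0 then T ^^ nat n else inv T ^^ nat (- n))"

definition isometry_op :: "('a::complex_hilbert \<Rightarrow> 'b::complex_hilbert) \<Rightarrow> bool"
  where "isometry_op V \<longleftrightarrow> bounded_clinear V \<and> (\<forall>x. norm (V x) = norm x)"

definition unitary_op :: "('a::complex_hilbert \<Rightarrow> 'a) \<Rightarrow> bool"
  where "unitary_op U \<longleftrightarrow>
    bounded_clinear U \<and> cadjoint U \<circ> U = id \<and> U \<circ> cadjoint U = id"

definition orth_projection :: "('a::complex_hilbert \<Rightarrow> 'a) \<Rightarrow> bool"
  where "orth_projection P \<longleftrightarrow> bounded_clinear P \<and> P \<circ> P = P \<and> cadjoint P = P"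

definition quantum_annulus :: "real \<Rightarrow> ('a::complex_hilbert \<Rightarrow> 'a) set"
  where "quantum_annulus r =
    {T. invertible_op T \<and> onorm T \<le> 1 / r \<and> onorm (inv T) \<le> 1 / r}"

text \<open>
  The operators that, up to unitary equivalence, are of the form \<open>U (r I \<oplus> r\<inverse> I)\<close> on a direct sum
  of two Hilbert spaces. Up to unitary equivalence such a direct sum is an orthogonal decomposition
  of the underlying space into the ranges of two complementary projections \<open>P\<close> and \<open>Q\<close>, possibly
  zero, and the block diagonal operator is \<open>r P + r\<inverse> Q\<close>.
\<close>

definition script_quantum_annulus :: "real \<Rightarrow> ('a::complex_hilbert \<Rightarrow> 'a) set"
  where "script_quantum_annulus r =
    {J. \<exists>U P Q. unitary_op U \<and> orth_projection P \<and> orth_projection Q \<and>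
          (\<forall>x. P x + Q x = x) \<and> (\<forall>x. J x = U (r *\<^sub>R P x + (1 / r) *\<^sub>R Q x))}"

definition dilates_via ::
    "('h::complex_hilbert \<Rightarrow> 'k::complex_hilbert) \<Rightarrow> ('h \<Rightarrow> 'h) \<Rightarrow> ('k \<Rightarrow> 'k) \<Rightarrow> bool"
  where "dilates_via V T J \<longleftrightarrow>
    invertible_op T \<and> invertible_op J \<and> isometry_op V \<and>
    (\<forall>n::int. op_powi T n = cadjoint V \<circ> op_powi J n \<circ> V)"

definition reduces :: "'k::complex_hilbert set \<Rightarrow> ('k \<Rightarrow> 'k) \<Rightarrow> bool"
  where "reduces M J \<longleftrightarrow> J ` M \<subseteq> M \<and> cadjoint J ` M \<subseteq> M"

text \<open>
  A definition cannot quantify over all Hilbert spaces, so the one on which the dilations act is a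
  type argument; a theorem with this type left as a variable speaks about all of them.
  Likewise, a statement that some dilation space exists has to name its type: one for an operator
  on \<open>'h\<close> can be found on the direct sum \<open>'h \<times> 'h\<close>.
\<close>

definition dilation_extremal ::
    "'k::complex_hilbert itself \<Rightarrow> real \<Rightarrow> ('h::complex_hilbert \<Rightarrow> 'h) \<Rightarrow> bool"
  where "dilation_extremal _ r T \<longleftrightarrow>
    T \<in> quantum_annulus r \<and>
    (\<forall>(J :: 'k \<Rightarrow> 'k) (V :: 'h \<Rightarrow> 'k).
       J \<in> quantum_annulus r \<and> dilates_via V T J \<longrightarrow> reduces (range V) J)"

definition unital_star_rep ::
    "(('k::complex_hilbert \<Rightarrow> 'k) \<Rightarrow> ('g::complex_hilbert \<Rightarrow> 'g)) \<Rightarrow> bool"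
  where "unital_star_rep \<pi> \<longleftrightarrow>
    (\<forall>A. bounded_clinear A \<longrightarrow> bounded_clinear (\<pi> A)) \<and>
    (\<forall>A B. bounded_clinear A \<and> bounded_clinear B \<longrightarrow>
       \<pi> (\<lambda>x. A x + B x) = (\<lambda>y. \<pi> A y + \<pi> B y)) \<and>
    (\<forall>c A. bounded_clinear A \<longrightarrow> \<pi> (\<lambda>x. c *\<^sub>C A x) = (\<lambda>y. c *\<^sub>C \<pi> A y)) \<and>
    (\<forall>A B. bounded_clinear A \<and> bounded_clinear B \<longrightarrow> \<pi> (A \<circ> B) = \<pi> A \<circ> \<pi> B) \<and>
    (\<forall>A. bounded_clinear A \<longrightarrow> \<pi> (cadjoint A) = cadjoint (\<pi> A)) \<and>
    \<pi> id = id"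

end

theory Submission
  imports Defs
begin

text \<open>
  Extremality: if \<open>S\<close> compresses \<open>S'\<close> with \<open>\<parallel>S'\<parallel> \<le> c\<close> and \<open>\<parallel>S x\<parallel> = c \<parallel>x\<parallel>\<close>, then equality holds in
  \<open>\<parallel>S x\<parallel> \<le> \<parallel>S' (V x)\<parallel> \<le> c \<parallel>x\<parallel>\<close>, so \<open>S' V x = V S x\<close> and \<open>S'\<^sup>* S' V x = c\<^sup>2 V x\<close>. For
  \<open>J = U (r P + r\<inverse> Q)\<close> this applies to \<open>J\<close> on the range of \<open>Q\<close> and to \<open>J\<inverse>\<close> on the image under \<open>J\<close>
  of the range of \<open>P\<close>.

  Dilation: with \<open>X = T\<^sup>* T\<close> and \<open>s = r\<^sup>2 + r\<^sup>-\<^sup>2\<close>, the operator \<open>s X - 1 - X\<^sup>2 = (X - r\<^sup>2) (r\<^sup>-\<^sup>2 - X)\<close> is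
  positive. If \<open>Y\<close> is its square root, then the upper triangular block operator \<open>J\<close> with diagonal
  \<open>T\<close>, \<open>(T\<^sup>*)\<inverse>\<close> and corner \<open>(T\<^sup>*)\<inverse> Y\<close> has \<open>M = J\<^sup>* J\<close> equal to the Halmos type dilation of \<open>X\<close> with
  rows \<open>X\<close>, \<open>Y\<close> and \<open>Y\<close>, \<open>s - X\<close>. It satisfies \<open>M\<^sup>2 - s M + 1 = 0\<close>, so its spectrum is contained in
  \<open>{r\<^sup>2, r\<^sup>-\<^sup>2}\<close>. As \<open>J\<close> is triangular, the compressions of its powers are the powers of \<open>T\<close>.
\<close>

section \<open>Riesz representation\<close>

instance complex_hilbert \<subseteq> banach ..

text \<open>Variational argument: the representing vector is the minimizer of \<open>g\<close>, the
  functional norm squared minus \<open>2 * f\<close>. The parallelogram law makes minimizing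
  sequences Cauchy, and vanishing of the first variation at the minimizer is the claim.\<close>

lemma riesz_representation:
  fixes f :: "'a::{real_inner,complete_space} \<Rightarrow> real"
  assumes "bounded_linear f"
  shows "\<exists>v. \<forall>x. f x = inner x v"
proof -
  interpret f: bounded_linear f by fact
  define g where "g x = (norm x)\<^sup>2 - 2 * f x" for x
  define m where "m = Inf (range g)"
  obtain K where K: "\<And>x. norm (f x) \<le> norm x * K"
    using f.bounded by blast
  have "- K\<^sup>2 \<le> g x" for x
  proof -
    have "f x \<le> norm x * K"
      using K[of x] by simp
    moreover have "0 \<le> (norm x - K)\<^sup>2"
      by simp
    ultimately show ?thesis
      unfolding g_def by (simp add: power2_diff)
  qed
  then have bdd: "bdd_below (range g)"
    by (intro bdd_belowI[of _ "- K\<^sup>2"]) auto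
  have m_le: "m \<le> g x" for x
    unfolding m_def by (intro cInf_lower bdd) auto
  have "\<exists>x. g x < m + inverse (real (Suc n))" for n
    using cInf_lessD[of "range g" "m + inverse (real (Suc n))"] by (auto simp: m_def)
  then obtain u where u: "\<And>n. g (u n) < m + inverse (real (Suc n))"
    by metis
  \<comment> \<open>The linear terms of \<open>g\<close> cancel in this combination, leaving the
    parallelogram law. The midpoint value is at least \<open>m\<close>, so two near-minimizers must
    be close to each other.\<close>
  have parallelogram: "(norm (x - y))\<^sup>2 = 2 * g x + 2 * g y - 4 * g ((1/2) *\<^sub>R (x + y))" for x y
    unfolding g_def f.scaleR f.add
    by (simp add: power2_norm_eq_inner algebra_simps inner_commute)
  have "Cauchy u"
  proof (rule metric_CauchyI)
    fix e :: real
    assume "0 < e"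
    \<comment> \<open>Each of the two values of \<open>g\<close> exceeds \<open>m\<close> by less
      than a quarter of \<open>e\<^sup>2\<close> and enters with factor 2.\<close>
    then obtain N where N: "inverse (real (Suc N)) < e\<^sup>2 / 4"
      using reals_Archimedean[of "e\<^sup>2 / 4"] by auto
    have "dist (u k) (u n) < e" if "N \<le> k" "N \<le> n" for k n
    proof -
      have "inverse (real (Suc k)) \<le> inverse (real (Suc N))"
        "inverse (real (Suc n)) \<le> inverse (real (Suc N))"
        using that by (auto intro!: le_imp_inverse_le)
      then have "(norm (u k - u n))\<^sup>2 < e\<^sup>2"
        using parallelogram[of "u k" "u n"] u[of k] u[of n] N m_le[of "(1/2) *\<^sub>R (u k + u n)"]
        by linarith
      then show ?thesis
        using \<open>0 < e\<close> by (simp add: dist_norm power2_less_imp_less)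
    qed
    then show "\<exists>N. \<forall>k\<ge>N. \<forall>n\<ge>N. dist (u k) (u n) < e"
      by blast
  qed
  then obtain v where v: "u \<longlonglongrightarrow> v"
    using Cauchy_convergent convergent_def by blast
  have "(\<lambda>n. g (u n)) \<longlonglongrightarrow> g v"
    unfolding g_def by (intro tendsto_intros v f.tendsto)
  moreover have "(\<lambda>n. m + inverse (real (Suc n))) \<longlonglongrightarrow> m + 0"
    by (intro tendsto_intros LIMSEQ_inverse_real_of_nat)
  ultimately have "g v \<le> m + 0"
    using u by (intro LIMSEQ_le) (auto intro: less_imp_le)
  then have min: "g v \<le> g x" for x
    using m_le[of x] by simp
  have "f x = inner x v" for x
  proof (cases "x = 0")
    case False
    define a where "a = f x - inner x v"
    \<comment> \<open>This \<open>t\<close> minimizes the quadratic increment of \<open>g\<close>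
      along \<open>x\<close>; the increment would be negative unless \<open>a = 0\<close>.\<close>
    define t where "t = a / inner x x"
    have N: "inner x x > 0"
      using False by simp
    have "g (v + t *\<^sub>R x) = g v - 2 * t * a + t\<^sup>2 * inner x x"
      unfolding g_def a_def f.add f.scaleR power2_norm_eq_inner
      by (simp add: algebra_simps inner_commute power2_eq_square)
    then have "2 * t * a \<le> t\<^sup>2 * inner x x"
      using min[of "v + t *\<^sub>R x"] by simp
    then have "a\<^sup>2 \<le> 0"
      using N by (simp add: t_def power2_eq_square field_simps)
    then show ?thesis
      by (simp add: a_def)
  qed (simp add: f.zero)
  then show ?thesis
    by blast
qed

section \<open>Bounded complex-linear operators\<close>

lemma bounded_clinearD:
  assumes "bounded_clinear A"
  shows "bounded_linear A" "A (x + y) = A x + A y" "A (x - y) = A x - A y"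
    "A (a *\<^sub>R x) = a *\<^sub>R A x" "A (c *\<^sub>C x) = c *\<^sub>C A x" "A 0 = 0"
  using assms linear_add linear_diff linear_scale linear_0
    bounded_linear.linear[of A]
  unfolding bounded_clinear_def by (auto simp: linear_add linear_diff linear_scale linear_0)

lemma scaleC_scaleR: "c *\<^sub>C a *\<^sub>R x = a *\<^sub>R c *\<^sub>C x"
  for x :: "'a::complex_hilbert"
  by (metis scaleC_complex_of_real scaleC_scaleC mult.commute)

lemma scaleC_minus_right: "c *\<^sub>C (- x) = - (c *\<^sub>C x)"
  for x :: "'a::complex_hilbert"
  using scaleC_scaleR[of c "-1" x] by simp

lemma scaleC_diff_right: "c *\<^sub>C (x - y) = c *\<^sub>C x - c *\<^sub>C y"
  for x :: "'a::complex_hilbert"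
  using scaleC_add_right[of c x "- y"] by (simp add: scaleC_minus_right)

lemma bounded_clinear_intros:
  shows "bounded_clinear id"
    and "bounded_clinear (\<lambda>x. x)"
    and "bounded_clinear A \<Longrightarrow> bounded_clinear B \<Longrightarrow> bounded_clinear (\<lambda>x. A (B x))"
    and "bounded_clinear A \<Longrightarrow> bounded_clinear C \<Longrightarrow> bounded_clinear (\<lambda>x. A x + C x)"
    and "bounded_clinear A \<Longrightarrow> bounded_clinear C \<Longrightarrow> bounded_clinear (\<lambda>x. A x - C x)"
    and "bounded_clinear A \<Longrightarrow> bounded_clinear (\<lambda>x. a *\<^sub>R A x)"
  unfolding bounded_clinear_def id_def
  by (auto intro: bounded_linear_intros bounded_linear_compose bounded_linear_add
      bounded_linear_sub bounded_linear_const_scaleR simp: scaleC_add_right scaleC_diff_right scaleC_scaleR)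

lemma bounded_clinear_zero: "bounded_clinear (\<lambda>x. 0)"
  unfolding bounded_clinear_def
  using scaleC_scaleR[of _ 0 0] by (auto simp: bounded_linear_zero)

lemma bounded_clinear_prod_intros:
  "bounded_clinear fst" "bounded_clinear snd"
  "bounded_clinear A \<Longrightarrow> bounded_clinear B \<Longrightarrow> bounded_clinear (\<lambda>x. (A x, B x))"
  unfolding bounded_clinear_def
  by (auto simp: scaleC_prod_def bounded_linear_fst bounded_linear_snd bounded_linear_Pair)

lemma Im_cinner: "Im (cinner x y) = - inner (\<i> *\<^sub>C x) y"
  by (simp add: cinner_scaleC_left flip: Re_cinner)

text \<open>The imaginary part of \<open>cinner x y\<close> is, up to sign, the real inner product
  of \<open>\<i> *\<^sub>C x\<close> with \<open>y\<close>, and \<open>A\<close> commutes with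
  \<open>\<i>\<close>. Adjoints can therefore be computed with the real inner product alone.\<close>

lemma cinner_eq_iff_inner:
  assumes "bounded_clinear A"
  shows "(\<forall>x y. cinner (A x) y = cinner x (B y)) \<longleftrightarrow> (\<forall>x y. inner (A x) y = inner x (B y))"
  by (metis Re_cinner Im_cinner complex_eqI assms bounded_clinearD(5))

lemma cinner_scaleC_right: "cinner x (c *\<^sub>C y) = cnj c * cinner x y"
  by (metis cinner_commute cinner_scaleC_left complex_cnj_mult complex_cnj_cnj)

lemma norm_scaleC: "norm (c *\<^sub>C x) = cmod c * norm x"
  for x :: "'a::complex_hilbert"
proof -
  have "complex_of_real ((norm (c *\<^sub>C x))\<^sup>2) = c * cnj c * complex_of_real ((norm x)\<^sup>2)"
    unfolding cinner_self[symmetric] cinner_scaleC_left cinner_scaleC_right by simp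
  also have "\<dots> = complex_of_real ((cmod c * norm x)\<^sup>2)"
    by (simp only: of_real_power of_real_mult power_mult_distrib flip: complex_norm_square)
  finally have "(norm (c *\<^sub>C x))\<^sup>2 = (cmod c * norm x)\<^sup>2"
    by (rule of_real_eq_iff[THEN iffD1])
  then show ?thesis
    by (rule power2_eq_imp_eq) simp_all
qed

lemma bounded_linear_scaleC: "bounded_linear (\<lambda>x::'a::complex_hilbert. c *\<^sub>C x)"
  by (rule bounded_linear_intro[of _ "cmod c"])
    (simp_all add: scaleC_add_right scaleC_scaleR norm_scaleC)

section \<open>Adjoints\<close>

lemma inner_eqI:
  fixes y z :: "'a::real_inner"
  assumes "\<And>x. inner x y = inner x z"
  shows "y = z"
  using assms[of "y - z"] inner_eq_zero_iff[of "y - z"] by (simp add: inner_diff_right)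

lemma cinner_eqI:
  fixes y z :: "'a::complex_hilbert"
  assumes "\<And>x. cinner x y = cinner x z"
  shows "y = z"
  by (rule inner_eqI) (simp add: assms flip: Re_cinner)

text \<open>Riesz, applied for each \<open>y\<close> to the functional sending \<open>x\<close> to
  \<open>inner (A x) y\<close>, provides a witness for the choice in
  \<open>cadjoint\<close>.\<close>

lemma cinner_cadjoint:
  fixes A :: "'a::complex_hilbert \<Rightarrow> 'b::complex_hilbert"
  assumes "bounded_clinear A"
  shows "cinner (A x) y = cinner x (cadjoint A y)"
proof -
  have "bounded_linear (\<lambda>x. inner (A x) y)" for y
    using bounded_linear_compose[OF bounded_linear_inner_left bounded_clinearD(1)[OF assms]] .
  then have "\<exists>v. \<forall>x. inner (A x) y = inner x v" for y
    by (rule riesz_representation)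
  then obtain B where "\<forall>x y. inner (A x) y = inner x (B y)"
    by metis
  then have "\<exists>B. \<forall>x y. cinner (A x) y = cinner x (B y)"
    using cinner_eq_iff_inner[OF assms] by blast
  then show ?thesis
    unfolding cadjoint_def by (rule someI2_ex) simp
qed

lemma inner_cadjoint: "bounded_clinear A \<Longrightarrow> inner (A x) y = inner x (cadjoint A y)"
  by (simp add: cinner_cadjoint flip: Re_cinner)

lemma inner_cadjoint': "bounded_clinear A \<Longrightarrow> inner x (A y) = inner (cadjoint A x) y"
  by (metis inner_cadjoint inner_commute)

lemma cadjoint_eqI:
  assumes "bounded_clinear A" "\<And>x y. inner (A x) y = inner x (B y)"
  shows "cadjoint A = B"
  by (rule ext, rule inner_eqI) (metis assms inner_cadjoint)

lemma norm_cadjoint_le: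
  assumes "bounded_clinear A" "\<And>x. norm (A x) \<le> c * norm x" "0 \<le> c"
  shows "norm (cadjoint A y) \<le> c * norm y"
proof (cases "cadjoint A y = 0")
  case False
  have "norm (cadjoint A y) * norm (cadjoint A y) = inner (A (cadjoint A y)) y"
    by (simp add: inner_cadjoint[OF assms(1)] power2_norm_eq_inner flip: power2_eq_square)
  also have "\<dots> \<le> norm (A (cadjoint A y)) * norm y"
    by (rule norm_cauchy_schwarz)
  also have "\<dots> \<le> c * norm (cadjoint A y) * norm y"
    by (intro mult_right_mono assms) auto
  also have "\<dots> = norm (cadjoint A y) * (c * norm y)"
    by simp
  finally show ?thesis
    using False by (simp add: mult_le_cancel_left)
qed (simp add: assms)

lemma bounded_clinear_cadjoint:
  fixes A :: "'a::complex_hilbert \<Rightarrow> 'b::complex_hilbert"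
  assumes "bounded_clinear A"
  shows "bounded_clinear (cadjoint A)"
proof -
  obtain K where K: "0 \<le> K" "\<And>x. norm (A x) \<le> K * norm x"
    using bounded_linear.nonneg_bounded[OF bounded_clinearD(1)[OF assms]]
    by (metis mult.commute)
  have "bounded_linear (cadjoint A)"
  proof (rule bounded_linear_intro)
    show "cadjoint A (x + y) = cadjoint A x + cadjoint A y" for x y
      by (rule inner_eqI) (simp add: inner_add_right flip: inner_cadjoint[OF assms])
    show "cadjoint A (a *\<^sub>R x) = a *\<^sub>R cadjoint A x" for a x
      by (rule inner_eqI) (simp flip: inner_cadjoint[OF assms])
    show "norm (cadjoint A x) \<le> norm x * K" for x
      using norm_cadjoint_le[OF assms K(2,1)] by (simp add: mult.commute)
  qed
  moreover have "cadjoint A (c *\<^sub>C x) = c *\<^sub>C cadjoint A x" for c x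
    by (rule cinner_eqI) (simp add: cinner_scaleC_right flip: cinner_cadjoint[OF assms])
  ultimately show ?thesis
    by (simp add: bounded_clinear_def)
qed

lemma cadjoint_cadjoint: "bounded_clinear A \<Longrightarrow> cadjoint (cadjoint A) = A"
  by (intro cadjoint_eqI bounded_clinear_cadjoint) (simp_all flip: inner_cadjoint')

text \<open>Equality case of the norm bound. Write \<open>w\<close> for the left-hand side: its norm
  is at most \<open>c\<^sup>2 * norm v\<close>, while \<open>inner w v\<close> is the square of
  \<open>norm (A v)\<close>. Expanding the squared norm of \<open>w - c\<^sup>2 *\<^sub>R v\<close>
  then gives at most zero.\<close>

lemma cadjoint_comp_eq_of_norm_max:
  assumes "bounded_clinear A" "\<And>x. norm (A x) \<le> c * norm x" "0 \<le> c"
    and "norm (A v) = c * norm v"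
  shows "cadjoint A (A v) = c\<^sup>2 *\<^sub>R v"
proof -
  let ?w = "cadjoint A (A v)"
  have "norm ?w \<le> c * (c * norm v)"
    using norm_cadjoint_le[OF assms(1-3), of "A v"] by (simp add: assms(4))
  then have "(norm ?w)\<^sup>2 \<le> (c * (c * norm v))\<^sup>2"
    by (simp add: power_mono)
  moreover have "inner ?w v = (c * norm v)\<^sup>2"
    by (simp add: assms(4) power2_norm_eq_inner flip: inner_cadjoint'[OF assms(1)] assms(4))
  moreover have "(norm (?w - c\<^sup>2 *\<^sub>R v))\<^sup>2 = (norm ?w)\<^sup>2 - 2 * c\<^sup>2 * inner ?w v + (c\<^sup>2 * norm v)\<^sup>2"
    unfolding power_mult_distrib power2_norm_eq_inner
    by (simp add: inner_diff_left inner_diff_right inner_commute power2_eq_square)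
  ultimately have "(norm (?w - c\<^sup>2 *\<^sub>R v))\<^sup>2 \<le> 0"
    by (simp add: power2_eq_square algebra_simps)
  then show ?thesis
    by simp
qed

section \<open>Invertible and unitary operators, orthogonal projections\<close>

lemma invertible_opI:
  assumes "bounded_clinear T" "bounded_clinear S" "\<And>x. S (T x) = x" "\<And>x. T (S x) = x"
  shows "invertible_op T" "inv T = S"
proof -
  have "S \<circ> T = id" "T \<circ> S = id"
    by (auto simp: assms)
  then show "invertible_op T" "inv T = S"
    using assms(1,2) inv_unique_comp[of T S] by (auto simp: invertible_op_def)
qed

lemma invertible_opD:
  assumes "invertible_op T"
  shows "bounded_clinear T" "bounded_clinear (inv T)" "inv T (T x) = x" "T (inv T x) = x"
proof -
  obtain S where S: "bounded_clinear S" "S \<circ> T = id" "T \<circ> S = id" "bounded_clinear T"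
    using assms unfolding invertible_op_def by blast
  then have "inv T = S"
    using inv_unique_comp by blast
  then show "bounded_clinear T" "bounded_clinear (inv T)" "inv T (T x) = x" "T (inv T x) = x"
    using S by (simp_all add: pointfree_idE)
qed

lemma cadjoint_inverse:
  assumes "invertible_op T"
  shows "cadjoint T (cadjoint (inv T) x) = x" "cadjoint (inv T) (cadjoint T x) = x"
  by (rule inner_eqI, simp add: invertible_opD[OF assms]
      flip: inner_cadjoint[OF invertible_opD(1)[OF assms]] inner_cadjoint[OF invertible_opD(2)[OF assms]])+

lemma unitary_opD:
  assumes "unitary_op U"
  shows "bounded_clinear U" "cadjoint U (U x) = x" "U (cadjoint U x) = x"
    "norm (U x) = norm x" "norm (cadjoint U x) = norm x"
proof -
  show U: "bounded_clinear U" "cadjoint U (U x) = x" "U (cadjoint U x) = x" for x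
    using assms by (auto simp: unitary_op_def fun_eq_iff)
  show n: "norm (U x) = norm x" for x
    by (simp add: norm_eq_sqrt_inner inner_cadjoint[OF U(1)] U)
  show "norm (cadjoint U x) = norm x"
    using n[of "cadjoint U x"] by (simp add: U)
qed

lemma orth_projection_iff:
  "orth_projection P \<longleftrightarrow>
    bounded_clinear P \<and> (\<forall>x. P (P x) = P x) \<and> (\<forall>x y. inner (P x) y = inner x (P y))"
  unfolding orth_projection_def fun_eq_iff o_def
  by (metis cadjoint_eqI inner_cadjoint)

text \<open>Inserting \<open>Q x\<close> into \<open>P + Q = id\<close> and using idempotence gives
  \<open>P (Q x) = 0\<close>. The ranges are then orthogonal and the norm identity is
  Pythagoras.\<close>

lemma complementary_projections:
  assumes "orth_projection P" "orth_projection Q" "\<And>x. P x + Q x = x"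
  shows "P (P x) = P x" "Q (Q x) = Q x" "P (Q x) = 0" "Q (P x) = 0"
    and "(norm (a *\<^sub>R P x + b *\<^sub>R Q x))\<^sup>2 = a\<^sup>2 * (norm (P x))\<^sup>2 + b\<^sup>2 * (norm (Q x))\<^sup>2"
proof -
  show P: "P (P x) = P x" "Q (Q x) = Q x" for x
    using assms(1,2) by (auto simp: orth_projection_iff)
  show PQ: "P (Q x) = 0" "Q (P x) = 0"
    using assms(3)[of "Q x"] assms(3)[of "P x"] by (auto simp: P)
  have "inner (P x) (Q x) = 0"
    using assms(1) PQ by (simp add: orth_projection_iff)
  then show "(norm (a *\<^sub>R P x + b *\<^sub>R Q x))\<^sup>2 = a\<^sup>2 * (norm (P x))\<^sup>2 + b\<^sup>2 * (norm (Q x))\<^sup>2"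
    unfolding power2_norm_eq_inner
    by (simp add: inner_add_left inner_add_right inner_commute power2_eq_square)
qed

lemma norm_projection_combination_le:
  assumes "orth_projection P" "orth_projection Q" "\<And>x. P x + Q x = x"
    and "\<bar>a\<bar> \<le> c" "\<bar>b\<bar> \<le> c"
  shows "norm (a *\<^sub>R P x + b *\<^sub>R Q x) \<le> c * norm x"
proof -
  have "(norm (a *\<^sub>R P x + b *\<^sub>R Q x))\<^sup>2 \<le> c\<^sup>2 * (norm (P x))\<^sup>2 + c\<^sup>2 * (norm (Q x))\<^sup>2"
    unfolding complementary_projections(5)[OF assms(1-3)]
    using assms(4,5) by (intro add_mono mult_right_mono abs_le_square_iff[THEN iffD1]) auto
  also have "\<dots> = c\<^sup>2 * (norm x)\<^sup>2"
    using complementary_projections(5)[OF assms(1-3), of 1 x 1] by (simp add: assms(3) distrib_left)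
  finally have "(norm (a *\<^sub>R P x + b *\<^sub>R Q x))\<^sup>2 \<le> (c * norm x)\<^sup>2"
    by (simp only: power_mult_distrib)
  moreover have "0 \<le> c * norm x"
    using order_trans[OF abs_ge_zero assms(4)] by (simp only: mult_nonneg_nonneg norm_ge_zero)
  ultimately show ?thesis
    by (rule power2_le_imp_le)
qed

section \<open>The extremal class and its inclusion in the quantum annulus\<close>

lemma script_quantum_annulusE:
  assumes "J \<in> script_quantum_annulus r" "0 < r"
  obtains U P Q where "unitary_op U" "orth_projection P" "orth_projection Q" "\<And>x. P x + Q x = x"
    "\<And>x. J x = U (r *\<^sub>R P x + (1 / r) *\<^sub>R Q x)"
    "inv J = (\<lambda>x. (1 / r) *\<^sub>R P (cadjoint U x) + r *\<^sub>R Q (cadjoint U x))"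
    "invertible_op J"
proof -
  obtain U P Q where U: "unitary_op U" and P: "orth_projection P" and Q: "orth_projection Q"
    and PQ: "\<And>x. P x + Q x = x" and J: "\<And>x. J x = U (r *\<^sub>R P x + (1 / r) *\<^sub>R Q x)"
    using assms(1) unfolding script_quantum_annulus_def by blast
  let ?S = "\<lambda>x. (1 / r) *\<^sub>R P (cadjoint U x) + r *\<^sub>R Q (cadjoint U x)"
  have lin: "bounded_clinear P" "bounded_clinear Q"
    using P Q by (auto simp: orth_projection_def)
  note simps = bounded_clinearD[OF lin(1)] bounded_clinearD[OF lin(2)]
    complementary_projections(1-4)[OF P Q PQ] unitary_opD[OF U] PQ
  have "bounded_clinear J"
    unfolding J[abs_def]
    by (rule bounded_clinear_intros(3)[OF unitary_opD(1)[OF U]])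
      (intro bounded_clinear_intros(4,6) lin)
  moreover have "bounded_clinear ?S"
    using lin[THEN bounded_clinear_intros(3), OF bounded_clinear_cadjoint[OF unitary_opD(1)[OF U]]]
    by (intro bounded_clinear_intros(4,6))
  moreover have "?S (J x) = x" "J (?S x) = x" for x
    using assms(2) by (simp_all add: J simps)
  ultimately have "invertible_op J" "inv J = ?S"
    by (rule invertible_opI)+
  then show thesis
    using that[OF U P Q PQ J] by simp
qed

text \<open>Up to a unitary factor, \<open>J\<close> and \<open>inv J\<close> are combinations of
  \<open>P\<close> and \<open>Q\<close> with coefficients \<open>r\<close> and \<open>1 / r\<close>,
  both at most \<open>1 / r\<close> because \<open>r < 1\<close>.\<close>

lemma script_quantum_annulus_subset:
  assumes "J \<in> script_quantum_annulus r" "0 < r" "r < 1"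
  shows "J \<in> quantum_annulus r"
proof -
  obtain U P Q where U: "unitary_op U" and PQ: "orth_projection P" "orth_projection Q" "\<And>x. P x + Q x = x"
    and J: "\<And>x. J x = U (r *\<^sub>R P x + (1 / r) *\<^sub>R Q x)"
    and invJ: "inv J = (\<lambda>x. (1 / r) *\<^sub>R P (cadjoint U x) + r *\<^sub>R Q (cadjoint U x))"
    and inv: "invertible_op J"
    by (rule script_quantum_annulusE[OF assms(1,2)], rule that)
  have r: "\<bar>r\<bar> \<le> 1 / r" "\<bar>1 / r\<bar> \<le> 1 / r" "0 \<le> 1 / r"
    using assms(2,3) mult_le_one[of r r] by (auto simp: field_simps)
  have "norm (J x) \<le> 1 / r * norm x" for x
    unfolding J unitary_opD(4)[OF U] by (rule norm_projection_combination_le[OF PQ r(1,2)])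
  moreover have "norm (inv J x) \<le> 1 / r * norm x" for x
    using norm_projection_combination_le[OF PQ r(2,1), of "cadjoint U x"]
    by (simp add: invJ unitary_opD(5)[OF U])
  ultimately show ?thesis
    unfolding quantum_annulus_def using inv r(3) by (auto intro: onorm_bound)
qed

lemma quantum_annulusD:
  assumes "T \<in> quantum_annulus r"
  shows "invertible_op T" "norm (T x) \<le> 1 / r * norm x" "norm (inv T x) \<le> 1 / r * norm x"
proof -
  show "invertible_op T"
    using assms by (simp add: quantum_annulus_def)
  then have "norm (T x) \<le> onorm T * norm x" "norm (inv T x) \<le> onorm (inv T) * norm x"
    by (auto intro: onorm bounded_clinearD(1) invertible_opD)
  moreover have "onorm T * norm x \<le> 1 / r * norm x" "onorm (inv T) * norm x \<le> 1 / r * norm x"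
    using assms by (intro mult_right_mono; simp add: quantum_annulus_def)+
  ultimately show "norm (T x) \<le> 1 / r * norm x" "norm (inv T x) \<le> 1 / r * norm x"
    by linarith+
qed

section \<open>Integer powers\<close>

lemma op_powi_1 [simp]: "op_powi T 1 = T"
  by (simp add: op_powi_def)

lemma op_powi_minus_1 [simp]: "op_powi T (- 1) = inv T"
  by (simp add: op_powi_def)

text \<open>Serves upper triangular block operators: if \<open>J\<close> and its inverse both
  preserve the first summand, then so do all integer powers.\<close>

lemma op_powi_fst_invariant:
  fixes J :: "'a \<times> 'b::zero \<Rightarrow> 'a \<times> 'b"
  assumes "\<And>x. J (x, 0) = (T x, 0)" "\<And>x. inv J (x, 0) = (inv T x, 0)"
  shows "op_powi J n (x, 0) = (op_powi T n x, 0)"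
proof -
  have pow: "(A ^^ k) (x, 0) = ((C ^^ k) x, 0)" if "\<And>x. A (x, 0) = (C x, 0)" for A :: "'a \<times> 'b \<Rightarrow> 'a \<times> 'b" and C k x
    by (induction k) (auto simp: that)
  show ?thesis
    using pow[of J T, OF assms(1)] pow[of "inv J" "inv T", OF assms(2)] by (simp add: op_powi_def)
qed

section \<open>Norm-maximal compressions and extremality\<close>

lemma norm_cadjoint_isometry_le:
  assumes "isometry_op V"
  shows "norm (cadjoint V w) \<le> norm w"
  using norm_cadjoint_le[of V 1] assms by (auto simp: isometry_op_def)

lemma norm_maximal_compression:
  assumes V: "isometry_op V" and S': "bounded_clinear S'" "\<And>y. norm (S' y) \<le> c * norm y" "0 \<le> c"
    and S: "S x = cadjoint V (S' (V x))" "norm (S x) = c * norm x"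
  shows "S' (V x) = V (S x)" "cadjoint S' (S' (V x)) = c\<^sup>2 *\<^sub>R V x"
proof -
  have V': "bounded_clinear V" "\<And>x. norm (V x) = norm x"
    using V by (auto simp: isometry_op_def)
  have "norm (S' (V x)) \<le> norm (S x)"
    using S'(2)[of "V x"] by (simp add: V' S(2))
  moreover have "norm (S x) \<le> norm (S' (V x))"
    by (simp add: S(1) norm_cadjoint_isometry_le[OF V])
  ultimately have eq: "norm (S' (V x)) = norm (S x)"
    by simp
  \<comment> \<open>The equality case for the contraction \<open>cadjoint V\<close> with constant 1:
    it does not shorten \<open>S' (V x)\<close>, so this vector is fixed by the projection
    \<open>V \<circ> cadjoint V\<close> onto the range of \<open>V\<close>.\<close>
  have "cadjoint (cadjoint V) (cadjoint V (S' (V x))) = 1\<^sup>2 *\<^sub>R S' (V x)"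
    by (rule cadjoint_comp_eq_of_norm_max)
      (simp_all add: bounded_clinear_cadjoint V' norm_cadjoint_isometry_le[OF V] eq flip: S(1))
  then show "S' (V x) = V (S x)"
    by (simp add: S(1) cadjoint_cadjoint V')
  show "cadjoint S' (S' (V x)) = c\<^sup>2 *\<^sub>R V x"
    using cadjoint_comp_eq_of_norm_max[OF S', of "V x"] by (simp add: eq S(2) V')
qed

lemma script_quantum_annulus_extremal:
  fixes J :: "'h::complex_hilbert \<Rightarrow> 'h"
  assumes J_in: "J \<in> script_quantum_annulus r" and r: "0 < r" "r < 1"
  shows "dilation_extremal TYPE('k::complex_hilbert) r J"
  unfolding dilation_extremal_def
proof (intro conjI allI impI script_quantum_annulus_subset[OF J_in r], elim conjE)
  fix J' :: "'k \<Rightarrow> 'k" and V :: "'h \<Rightarrow> 'k"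
  assume J': "J' \<in> quantum_annulus r" and dil: "dilates_via V J J'"
  obtain U P Q where U: "unitary_op U" and PQ: "orth_projection P" "orth_projection Q" "\<And>x. P x + Q x = x"
    and J: "\<And>x. J x = U (r *\<^sub>R P x + (1 / r) *\<^sub>R Q x)"
    and "inv J = (\<lambda>x. (1 / r) *\<^sub>R P (cadjoint U x) + r *\<^sub>R Q (cadjoint U x))" and inv: "invertible_op J"
    by (rule script_quantum_annulusE[OF J_in r(1)], rule that)
  note J'D = quantum_annulusD[OF J'] invertible_opD[OF quantum_annulusD(1)[OF J']]
  note JD = invertible_opD[OF inv]
  have r': "0 \<le> 1 / r"
    using r by simp
  have V: "isometry_op V" and pow: "\<And>n. op_powi J n = cadjoint V \<circ> op_powi J' n \<circ> V"
    using dil by (auto simp: dilates_via_def)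
  have V': "bounded_clinear V"
    using V by (simp add: isometry_op_def)
  have comp: "J x = cadjoint V (J' (V x))" "inv J x = cadjoint V (inv J' (V x))" for x
    using pow[of 1] pow[of "- 1"] by (simp_all add: fun_eq_iff)
  note proj = complementary_projections(1-4)[OF PQ]
  \<comment> \<open>On the range of \<open>Q\<close>, \<open>J\<close> attains the maximal
    stretching factor \<open>1 / r\<close>, so the compression lemma applies to \<open>J\<close>
    itself.\<close>
  have q: "J' (V (Q x)) = V (J (Q x))" "cadjoint J' (V (J (Q x))) = V ((1 / r)\<^sup>2 *\<^sub>R Q x)" for x
  proof -
    have "norm (J (Q x)) = 1 / r * norm (Q x)"
      using r by (simp add: J proj unitary_opD(4)[OF U])
    from norm_maximal_compression[of V J' "1 / r" J "Q x", OF V J'D(4,2) r' comp(1) this]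
    show "J' (V (Q x)) = V (J (Q x))" "cadjoint J' (V (J (Q x))) = V ((1 / r)\<^sup>2 *\<^sub>R Q x)"
      by (simp_all add: bounded_clinearD[OF V'])
  qed
  \<comment> \<open>On the range of \<open>P\<close>, \<open>J\<close> shrinks by \<open>r\<close>,
    so \<open>inv J\<close> is norm-maximal at \<open>J (P x)\<close>. The resulting identities for
    \<open>inv J'\<close> are turned into identities for \<open>J'\<close> by applying
    \<open>J'\<close> and its adjoint.\<close>
  have p: "J' (V (P x)) = V (J (P x))" "cadjoint J' (V (J (P x))) = V (r\<^sup>2 *\<^sub>R P x)" for x
  proof -
    have "norm (inv J (J (P x))) = 1 / r * norm (J (P x))"
      using r by (simp add: JD) (simp add: J proj unitary_opD(4)[OF U])
    from norm_maximal_compression[of V "inv J'" "1 / r" "inv J" "J (P x)", OF V J'D(5,3) r' comp(2) this]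
    have 1: "inv J' (V (J (P x))) = V (P x)"
      and 2: "cadjoint (inv J') (V (P x)) = (1 / r)\<^sup>2 *\<^sub>R V (J (P x))"
      by (simp_all add: JD)
    show "J' (V (P x)) = V (J (P x))"
      by (simp add: J'D flip: 1)
    have "V (P x) = (1 / r)\<^sup>2 *\<^sub>R cadjoint J' (V (J (P x)))"
      using arg_cong[OF 2, of "cadjoint J'"]
      by (simp add: cadjoint_inverse J'D(1) bounded_clinearD[OF bounded_clinear_cadjoint[OF J'D(4)]])
    then show "cadjoint J' (V (J (P x))) = V (r\<^sup>2 *\<^sub>R P x)"
      using r by (simp add: bounded_clinearD[OF V'] power_divide)
  qed
  note lin = bounded_clinearD(2)[OF V'] bounded_clinearD(2)[OF J'D(4)] bounded_clinearD(2)[OF JD(1)]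
    bounded_clinearD(2)[OF bounded_clinear_cadjoint[OF J'D(4)]]
  have "J' (V x) = V (J x)" for x
    using lin(1)[of "J (P x)" "J (Q x)"] by (simp add: PQ(3) flip: p(1) q(1) lin)
  moreover have "cadjoint J' (V x) \<in> range V" for x
  proof -
    \<comment> \<open>\<open>J\<close> is surjective, so writing \<open>x = J z\<close> and
      splitting \<open>z\<close> reduces the claim to the formulas for \<open>cadjoint J'\<close> on
      images under \<open>J\<close>.\<close>
    define z where "z = inv J x"
    have "cadjoint J' (V (J (P z + Q z))) = V (r\<^sup>2 *\<^sub>R P z + (1 / r)\<^sup>2 *\<^sub>R Q z)"
      by (simp only: lin p q)
    then show ?thesis
      by (simp add: PQ z_def JD)
  qed
  ultimately show "reduces (range V) J'"
    unfolding reduces_def by auto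
qed

section \<open>Unital star representations\<close>

text \<open>Being unitary, being complementary projections and the factorization of \<open>J\<close>
  are algebraic relations between operators and adjoints, hence preserved by
  \<open>\<pi>\<close>.\<close>

lemma script_quantum_annulus_star_rep:
  fixes \<pi> :: "('h::complex_hilbert \<Rightarrow> 'h) \<Rightarrow> ('g::complex_hilbert \<Rightarrow> 'g)"
  assumes "J \<in> script_quantum_annulus r" "unital_star_rep \<pi>"
  shows "\<pi> J \<in> script_quantum_annulus r"
proof -
  obtain U P Q where U: "unitary_op U" and PQ: "orth_projection P" "orth_projection Q" "\<And>x. P x + Q x = x"
    and J: "\<And>x. J x = U (r *\<^sub>R P x + (1 / r) *\<^sub>R Q x)"
    using assms(1) unfolding script_quantum_annulus_def by blast
  have lin: "bounded_clinear U" "bounded_clinear P" "bounded_clinear Q"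
    using U PQ by (auto simp: unitary_op_def orth_projection_def)
  have rep: "bounded_clinear A \<Longrightarrow> bounded_clinear (\<pi> A)"
    "bounded_clinear A \<Longrightarrow> bounded_clinear B \<Longrightarrow> \<pi> (\<lambda>x. A x + B x) = (\<lambda>y. \<pi> A y + \<pi> B y)"
    "bounded_clinear A \<Longrightarrow> \<pi> (\<lambda>x. c *\<^sub>C A x) = (\<lambda>y. c *\<^sub>C \<pi> A y)"
    "bounded_clinear A \<Longrightarrow> bounded_clinear B \<Longrightarrow> \<pi> (A \<circ> B) = \<pi> A \<circ> \<pi> B"
    "bounded_clinear A \<Longrightarrow> \<pi> (cadjoint A) = cadjoint (\<pi> A)" "\<pi> id = id" for A B c
    using assms(2) by (auto simp: unital_star_rep_def)
  have scaleR: "\<pi> (\<lambda>x. a *\<^sub>R A x) = (\<lambda>y. a *\<^sub>R \<pi> A y)" if "bounded_clinear A" for a A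
    using rep(3)[OF that, of "complex_of_real a"] by (simp add: scaleC_complex_of_real)
  have proj: "orth_projection (\<pi> A)" if "orth_projection A" for A
    using that rep(1,5)[of A] rep(4)[of A A] by (simp add: orth_projection_def)
  have "unitary_op (\<pi> U)"
    using U rep(1,5)[of U] rep(4)[of U "cadjoint U"] rep(4)[of "cadjoint U" U] rep(6)
      bounded_clinear_cadjoint[of U]
    by (simp add: unitary_op_def)
  moreover have "\<pi> P x + \<pi> Q x = x" for x
    using rep(2)[OF lin(2,3)] rep(6) by (simp add: PQ(3) fun_eq_iff id_def)
  moreover have "\<pi> J = \<pi> U \<circ> (\<lambda>x. r *\<^sub>R \<pi> P x + (1 / r) *\<^sub>R \<pi> Q x)"
  proof -
    have "J = U \<circ> (\<lambda>x. r *\<^sub>R P x + (1 / r) *\<^sub>R Q x)"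
      by (simp add: fun_eq_iff J)
    then show ?thesis
      by (simp add: rep(2,4) scaleR lin bounded_clinear_intros(4,6))
  qed
  ultimately show ?thesis
    unfolding script_quantum_annulus_def mem_Collect_eq using proj[OF PQ(1)] proj[OF PQ(2)]
    by (intro exI[of _ "\<pi> U"] exI[of _ "\<pi> P"] exI[of _ "\<pi> Q"]) simp
qed

section \<open>Square roots by fixed point iteration\<close>

text \<open>For a symmetric contraction \<open>A\<close>, the square root of \<open>I - A\<close> is \<open>I - B\<close>, where \<open>B\<close> solves
  \<open>B = (A + B\<^sup>2) / 2\<close>. The fixed point iteration for \<open>B\<close> is dominated in norm by the same iteration
  for the number 1.\<close>

primrec sqrt_iter :: "('a \<Rightarrow> 'a) \<Rightarrow> nat \<Rightarrow> 'a \<Rightarrow> 'a::real_vector"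
  where "sqrt_iter A 0 = (\<lambda>x. 0)"
  | "sqrt_iter A (Suc n) = (\<lambda>x. (1/2) *\<^sub>R (A x + sqrt_iter A n (sqrt_iter A n x)))"

primrec sqrt_bound :: "nat \<Rightarrow> real"
  where "sqrt_bound 0 = 0"
  | "sqrt_bound (Suc n) = (1 + (sqrt_bound n)\<^sup>2) / 2"

lemma sqrt_bound_range: "0 \<le> sqrt_bound n" "sqrt_bound n \<le> 1"
proof -
  have "0 \<le> sqrt_bound n \<and> sqrt_bound n \<le> 1"
    by (induction n) (auto simp: power_le_one)
  then show "0 \<le> sqrt_bound n" "sqrt_bound n \<le> 1"
    by auto
qed

lemma sqrt_bound_le_Suc: "sqrt_bound n \<le> sqrt_bound (Suc n)"
proof -
  have "0 \<le> (1 - sqrt_bound n)\<^sup>2"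
    by simp
  then show ?thesis
    by (simp add: power2_diff)
qed

text \<open>The scalar sequence is increasing and bounded by 1, so its increments telescope to a
  finite sum; they will majorize the increments of the operator iteration.\<close>

lemma summable_sqrt_bound_diff: "summable (\<lambda>n. sqrt_bound (Suc n) - sqrt_bound n)"
proof -
  have "incseq sqrt_bound"
    by (rule incseq_SucI) (rule sqrt_bound_le_Suc)
  then obtain L where "sqrt_bound \<longlonglongrightarrow> L"
    using incseq_convergent[of sqrt_bound 1] sqrt_bound_range(2) by blast
  then show ?thesis
    by (rule telescope_summable)
qed

lemma bounded_clinear_sqrt_iter:
  assumes "bounded_clinear A"
  shows "bounded_clinear (sqrt_iter A n)"
proof (induction n)
  case (Suc n)
  show ?case
    unfolding sqrt_iter.simps
    by (intro bounded_clinear_intros(4,6) assms bounded_clinear_intros(3)[OF Suc Suc])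
qed (simp add: bounded_clinear_zero)

text \<open>The iterates are polynomials in \<open>A\<close>.\<close>

lemma sqrt_iter_commute:
  assumes "bounded_clinear C" "\<And>x. C (A x) = A (C x)"
  shows "C (sqrt_iter A n x) = sqrt_iter A n (C x)"
  by (induction n arbitrary: x) (simp_all add: bounded_clinearD[OF assms(1)] assms(2))

lemma sqrt_iter_symmetric:
  assumes "\<And>x y. inner (A x) y = inner x (A y)"
  shows "inner (sqrt_iter A n x) y = inner x (sqrt_iter A n y)"
  by (induction n arbitrary: x y) (simp_all add: assms inner_add_left inner_add_right)

lemma norm_sqrt_iter_le:
  assumes "bounded_clinear A" "\<And>x. norm (A x) \<le> norm x"
  shows "norm (sqrt_iter A n x) \<le> sqrt_bound n * norm x"
proof (induction n arbitrary: x)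
  case (Suc n)
  have "norm (sqrt_iter A n (sqrt_iter A n x)) \<le> sqrt_bound n * norm (sqrt_iter A n x)"
    by (rule Suc)
  also have "\<dots> \<le> sqrt_bound n * (sqrt_bound n * norm x)"
    by (intro mult_left_mono Suc sqrt_bound_range)
  finally have "norm (A x + sqrt_iter A n (sqrt_iter A n x)) \<le> norm x + sqrt_bound n * (sqrt_bound n * norm x)"
    by (intro norm_triangle_le add_mono assms)
  then show ?case
    by (simp add: algebra_simps power2_eq_square del: scaleR_add_right)
qed simp

text \<open>Consecutive iterates commute, so the difference of their squares factors as sum times
  difference. The scalar recursion factors in the same way, which carries the bound from
  \<open>n\<close> to \<open>Suc n\<close>.\<close>

lemma norm_sqrt_iter_diff_le:
  assumes "bounded_clinear A" "\<And>x. norm (A x) \<le> norm x"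
  shows "norm (sqrt_iter A (Suc n) x - sqrt_iter A n x) \<le> (sqrt_bound (Suc n) - sqrt_bound n) * norm x"
proof (induction n arbitrary: x)
  case 0
  show ?case
    using assms(2)[of x] by simp
next
  case (Suc n)
  let ?B = "sqrt_iter A" and ?b = sqrt_bound
  define u where "u = ?B (Suc n) x - ?B n x"
  note lin = bounded_clinearD[OF bounded_clinear_sqrt_iter[OF assms(1)]]
  have comm: "?B (Suc n) (?B n x) = ?B n (?B (Suc n) x)"
    by (intro sqrt_iter_commute bounded_clinear_sqrt_iter assms(1) sqrt_iter_commute[symmetric]) simp
  define p q where "p = ?B (Suc n) (?B (Suc n) x)" and "q = ?B n (?B n x)"
  have "?B (Suc (Suc n)) x = (1/2) *\<^sub>R (A x + p)" "?B (Suc n) x = (1/2) *\<^sub>R (A x + q)"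
    unfolding p_def q_def by (rule fun_cong[OF sqrt_iter.simps(2)])+
  then have "?B (Suc (Suc n)) x - ?B (Suc n) x = (1/2) *\<^sub>R (p - q)"
    by (simp only: scaleR_diff_right[symmetric] add_diff_cancel_left)
  also have "p - q = ?B (Suc n) u + ?B n u"
    unfolding p_def q_def u_def lin(3) comm by simp
  finally have eq: "?B (Suc (Suc n)) x - ?B (Suc n) x = (1/2) *\<^sub>R (?B (Suc n) u + ?B n u)" .
  have "norm (?B (Suc n) u + ?B n u) \<le> ?b (Suc n) * norm u + ?b n * norm u"
    by (intro norm_triangle_le add_mono norm_sqrt_iter_le assms)
  also have "\<dots> = (?b (Suc n) + ?b n) * norm u"
    by (simp only: distrib_right)
  also have "\<dots> \<le> (?b (Suc n) + ?b n) * ((?b (Suc n) - ?b n) * norm x)"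
    unfolding u_def by (intro mult_left_mono Suc add_nonneg_nonneg sqrt_bound_range)
  also have "\<dots> = ((?b (Suc n) + ?b n) * (?b (Suc n) - ?b n)) * norm x"
    by (simp only: mult.assoc)
  also have "(?b (Suc n) + ?b n) * (?b (Suc n) - ?b n) = 2 * (?b (Suc (Suc n)) - ?b (Suc n))"
  proof -
    have "(?b n)\<^sup>2 = 2 * ?b (Suc n) - 1" "2 * ?b (Suc (Suc n)) = 1 + (?b (Suc n))\<^sup>2"
      by (simp_all add: field_simps)
    then show ?thesis
      by (simp only: power2_eq_square algebra_simps)
  qed
  finally have "norm (?B (Suc n) u + ?B n u) \<le> 2 * ((?b (Suc (Suc n)) - ?b (Suc n)) * norm x)"
    by (simp only: mult.assoc)
  then show ?case
    unfolding eq norm_scaleR by simp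
qed

text \<open>\<open>B\<close> is the pointwise limit of the iterates. The fixed point equation says
  that the square of \<open>id - B\<close> is \<open>id - A\<close>; symmetry and commutation pass
  to the limit.\<close>

lemma ex_one_minus_sqrt:
  fixes A :: "'a::complex_hilbert \<Rightarrow> 'a"
  assumes A: "bounded_clinear A" "\<And>x. norm (A x) \<le> norm x"
    and sym: "\<And>x y. inner (A x) y = inner x (A y)"
  obtains B where "bounded_clinear B" "\<And>x. 2 *\<^sub>R B x = A x + B (B x)"
    "\<And>x y. inner (B x) y = inner x (B y)"
    "\<forall>C. bounded_clinear C \<and> (\<forall>x. C (A x) = A (C x)) \<longrightarrow> (\<forall>x. C (B x) = B (C x))"
proof -
  define B where "B x = lim (\<lambda>n. sqrt_iter A n x)" for x
  note lin = bounded_clinearD[OF bounded_clinear_sqrt_iter[OF A(1)]]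
  have B: "(\<lambda>n. sqrt_iter A n x) \<longlonglongrightarrow> B x" for x
  proof -
    have "summable (\<lambda>n. sqrt_iter A (Suc n) x - sqrt_iter A n x)"
      by (rule summable_comparison_test[OF _ summable_mult2[OF summable_sqrt_bound_diff, of "norm x"]])
        (use norm_sqrt_iter_diff_le[OF A] in blast)
    then have "(\<lambda>n. \<Sum>k<n. sqrt_iter A (Suc k) x - sqrt_iter A k x) \<longlonglongrightarrow>
        (\<Sum>k. sqrt_iter A (Suc k) x - sqrt_iter A k x)"
      by (rule summable_LIMSEQ)
    then have "convergent (\<lambda>n. sqrt_iter A n x)"
      unfolding sum_lessThan_telescope[of "\<lambda>n. sqrt_iter A n x"] sqrt_iter.simps(1) diff_zero
      by (rule convergentI)
    then show ?thesis
      unfolding B_def by (rule convergent_LIMSEQ_iff[THEN iffD1])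
  qed
  have contr: "norm (sqrt_iter A n x) \<le> norm x" for n x
    using norm_sqrt_iter_le[OF A, of n x] mult_right_mono[OF sqrt_bound_range(2), of "norm x" n]
    by simp
  have "bounded_linear B"
  proof (rule bounded_linear_intro[of _ 1])
    show "B (x + y) = B x + B y" for x y
      using LIMSEQ_unique[OF B[of "x + y"]] tendsto_add[OF B[of x] B[of y]] by (simp add: lin)
    show "B (a *\<^sub>R x) = a *\<^sub>R B x" for a x
      using LIMSEQ_unique[OF B[of "a *\<^sub>R x"]] tendsto_scaleR[OF tendsto_const B[of x]] by (simp add: lin)
    show "norm (B x) \<le> norm x * 1" for x
      using LIMSEQ_le_const2[OF tendsto_norm[OF B[of x]], of "norm x"] contr by simp
  qed
  moreover have "B (c *\<^sub>C x) = c *\<^sub>C B x" for c x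
    using LIMSEQ_unique[OF B[of "c *\<^sub>C x"]] bounded_linear.tendsto[OF bounded_linear_scaleC B[of x]]
    by (simp add: lin)
  ultimately have Blin: "bounded_clinear B"
    by (simp add: bounded_clinear_def)
  \<comment> \<open>Both factors vary with \<open>n\<close>. The iterates are contractions uniformly
    in \<open>n\<close>, so replacing the inner iterate by \<open>B x\<close> costs an error tending
    to zero.\<close>
  have BB: "(\<lambda>n. sqrt_iter A n (sqrt_iter A n x)) \<longlonglongrightarrow> B (B x)" for x
  proof -
    have "(\<lambda>n. sqrt_iter A n x - B x) \<longlonglongrightarrow> 0"
      using B[of x] by (simp add: LIM_zero)
    then have "(\<lambda>n. sqrt_iter A n (sqrt_iter A n x - B x)) \<longlonglongrightarrow> 0"
      by (rule Lim_null_comparison[rotated, OF tendsto_norm_zero]) (simp add: contr)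
    then have "(\<lambda>n. sqrt_iter A n (sqrt_iter A n x - B x) + sqrt_iter A n (B x)) \<longlonglongrightarrow> 0 + B (B x)"
      by (intro tendsto_add B)
    then show ?thesis
      by (simp add: lin(3))
  qed
  have fixpoint: "2 *\<^sub>R B x = A x + B (B x)" for x
  proof -
    have "(\<lambda>n. 2 *\<^sub>R sqrt_iter A (Suc n) x) \<longlonglongrightarrow> A x + B (B x)"
      using tendsto_add[OF tendsto_const BB] by simp
    moreover have "(\<lambda>n. 2 *\<^sub>R sqrt_iter A (Suc n) x) \<longlonglongrightarrow> 2 *\<^sub>R B x"
      by (intro tendsto_scaleR tendsto_const LIMSEQ_Suc B)
    ultimately show ?thesis
      using LIMSEQ_unique by blast
  qed
  have Bsym: "inner (B x) y = inner x (B y)" for x y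
    using LIMSEQ_unique[OF tendsto_inner[OF B[of x] tendsto_const[of y]]]
      tendsto_inner[OF tendsto_const[of x] B[of y]]
    by (simp add: sqrt_iter_symmetric[of A, OF sym])
  have comm: "C (B x) = B (C x)" if "bounded_clinear C" "\<And>x. C (A x) = A (C x)" for C x
    using LIMSEQ_unique[OF B[of "C x"]]
      bounded_linear.tendsto[OF bounded_clinearD(1)[OF that(1)] B[of x]]
    by (simp add: sqrt_iter_commute[of C A, OF that])
  show thesis
    using that[OF Blin fixpoint Bsym] comm by blast
qed

text \<open>For a symmetric operator the quadratic form controls the norm, by polarization between
  \<open>x\<close> and the multiple \<open>y\<close> of \<open>D x\<close> that has the length of
  \<open>x\<close>.\<close>

lemma symmetric_contraction:
  fixes D :: "'a::complex_hilbert \<Rightarrow> 'a"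
  assumes lin: "bounded_clinear D" and sym: "\<And>x y. inner (D x) y = inner x (D y)"
    and bound: "\<And>x. \<bar>inner (D x) x\<bar> \<le> (norm x)\<^sup>2"
  shows "norm (D x) \<le> norm x"
proof (cases "D x = 0 \<or> x = 0")
  case False
  define t where "t = norm x / norm (D x)"
  define y where "y = t *\<^sub>R D x"
  have "norm y = norm x"
    using False by (simp add: y_def t_def)
  have "4 * inner (D x) y = inner (D (x + y)) (x + y) - inner (D (x - y)) (x - y)"
    using sym[of y x] by (simp add: bounded_clinearD[OF lin] inner_add_left inner_add_right
        inner_diff_left inner_diff_right inner_commute)
  also have "\<dots> \<le> (norm (x + y))\<^sup>2 + (norm (x - y))\<^sup>2"
    using bound[of "x + y"] bound[of "x - y"] by linarith
  also have "\<dots> = 2 * (norm x)\<^sup>2 + 2 * (norm y)\<^sup>2"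
    unfolding power2_norm_eq_inner
    by (simp add: inner_add_left inner_add_right inner_diff_left inner_diff_right inner_commute)
  also have "\<dots> = 4 * (norm x)\<^sup>2"
    by (simp add: \<open>norm y = norm x\<close>)
  finally have "inner (D x) y \<le> norm x * norm x"
    by (simp add: power2_eq_square)
  moreover have "inner (D x) y = norm x * norm (D x)"
    using False by (simp add: y_def t_def power2_eq_square flip: power2_norm_eq_inner)
  ultimately show ?thesis
    using False by simp
qed (auto simp: bounded_clinearD[OF lin])

section \<open>Construction of the dilation\<close>

text \<open>The hypothesis says that \<open>cadjoint J \<circ> J\<close> is a root of the quadratic
  with zeros \<open>r\<^sup>2\<close> and \<open>(1 / r)\<^sup>2\<close>. Its spectral projections
  are then explicit, and the polar decomposition of \<open>J\<close> gives the required
  form.\<close>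

lemma script_quantum_annulusI:
  fixes J :: "'a::complex_hilbert \<Rightarrow> 'a"
  assumes J: "invertible_op J" and r: "0 < r" "r < 1"
    and quad: "\<And>x. cadjoint J (J (cadjoint J (J x))) = (r\<^sup>2 + (1 / r)\<^sup>2) *\<^sub>R cadjoint J (J x) - x"
  shows "J \<in> script_quantum_annulus r"
proof -
  define M where "M x = cadjoint J (J x)" for x
  define a b k where "a = r\<^sup>2" and "b = (1 / r)\<^sup>2" and "k = 1 / (b - a)"
  \<comment> \<open>Lagrange interpolation: \<open>P\<close> and \<open>Q\<close> project onto the
    eigenspaces of \<open>M\<close> for \<open>a\<close> and \<open>b\<close>.\<close>
  define P Q where "P x = k *\<^sub>R (b *\<^sub>R x - M x)" and "Q x = k *\<^sub>R (M x - a *\<^sub>R x)" for x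
  have ab: "a * b = 1"
    using r by (simp add: a_def b_def power2_eq_square)
  have "a < 1"
    unfolding a_def using r power_strict_mono[of r 1 2] by simp
  moreover have "1 < b"
    unfolding b_def using r by (intro one_less_power) auto
  ultimately have "b - a \<noteq> 0"
    by simp
  then have k: "k * (b - a) = 1"
    by (simp add: k_def)
  note JD = invertible_opD[OF J]
  have M: "bounded_clinear M"
    unfolding M_def by (rule bounded_clinear_intros(3)[OF bounded_clinear_cadjoint]) (rule JD(1))+
  have M_sym: "inner (M x) y = inner x (M y)" for x y
    by (simp add: M_def flip: inner_cadjoint[OF JD(1)] inner_cadjoint'[OF JD(1)])
  have MM: "M (M x) = (a + b) *\<^sub>R M x - (a * b) *\<^sub>R x" for x
    using quad[of x] by (simp only: M_def ab scaleR_one a_def[symmetric] b_def[symmetric])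
  have lin: "bounded_clinear P" "bounded_clinear Q"
    unfolding P_def Q_def by (intro bounded_clinear_intros(2,5,6) M)+
  have MP: "M (P x) = a *\<^sub>R P x" and MQ: "M (Q x) = b *\<^sub>R Q x" for x
    by (simp_all add: P_def Q_def bounded_clinearD[OF M] MM algebra_simps)
  have PQ: "P x + Q x = x" for x
  proof -
    have "P x + Q x = (k * (b - a)) *\<^sub>R x"
      by (simp add: P_def Q_def algebra_simps)
    then show ?thesis
      by (simp add: k)
  qed
  have "P (P x) = (k * (b - a)) *\<^sub>R P x" "Q (Q x) = (k * (b - a)) *\<^sub>R Q x" for x
    by (simp_all add: P_def[of "P x"] Q_def[of "Q x"] MP MQ algebra_simps)
  then have idem: "P (P x) = P x" "Q (Q x) = Q x" for x
    by (simp_all add: k)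
  have sym: "inner (P x) y = inner x (P y)" "inner (Q x) y = inner x (Q y)" for x y
    by (simp_all add: P_def Q_def M_sym inner_diff_left inner_diff_right)
  have proj: "orth_projection P" "orth_projection Q"
    by (simp_all add: orth_projection_iff lin idem sym)
  \<comment> \<open>\<open>N\<close> is the inverse of the positive square root of \<open>M\<close>,
    so \<open>U\<close> is the polar factor of \<open>J\<close>.\<close>
  define N where "N x = (1 / r) *\<^sub>R P x + r *\<^sub>R Q x" for x
  define U where "U x = J (N x)" for x
  note simps = bounded_clinearD[OF lin(1)] bounded_clinearD[OF lin(2)]
    complementary_projections(1-4)[OF proj PQ] PQ
  have N: "bounded_clinear N"
    unfolding N_def by (intro bounded_clinear_intros(4,6) lin)
  have U: "bounded_clinear U"
    unfolding U_def by (rule bounded_clinear_intros(3)[OF JD(1) N])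
  have ND: "N (r *\<^sub>R P x + (1 / r) *\<^sub>R Q x) = x" for x
    using r by (simp add: N_def simps)
  have adj: "cadjoint U = (\<lambda>y. N (cadjoint J y))"
    by (rule cadjoint_eqI[OF U])
      (simp add: U_def inner_cadjoint[OF JD(1)], simp add: N_def inner_add_left inner_add_right sym)
  have UU: "cadjoint U (U x) = x" for x
  proof -
    have "M (N x) = r *\<^sub>R P x + (1 / r) *\<^sub>R Q x"
      using r by (simp add: N_def bounded_clinearD[OF M] MP MQ a_def b_def power2_eq_square)
    then show ?thesis
      by (simp add: adj U_def ND flip: M_def)
  qed
  have J_eq: "J x = U (r *\<^sub>R P x + (1 / r) *\<^sub>R Q x)" for x
    by (simp add: U_def ND)
  \<comment> \<open>Surjectivity of \<open>J\<close> makes \<open>U\<close> surjective, so its left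
    inverse is also a right inverse.\<close>
  then have "U (cadjoint U y) = y" for y
    by (metis JD(4) UU)
  then have "unitary_op U"
    using U UU by (auto simp: unitary_op_def)
  then show ?thesis
    unfolding script_quantum_annulus_def mem_Collect_eq
    by (intro exI[of _ U] exI[of _ P] exI[of _ Q]) (simp add: proj PQ J_eq)
qed

text \<open>The bounds on \<open>T\<close> and \<open>inv T\<close> place the quadratic form of
  \<open>X\<close> between \<open>a\<close> and \<open>b\<close>. The affine rescaling
  \<open>D\<close> is then a contraction, the operator on the right is \<open>d * d\<close> times
  \<open>id - D \<circ> D\<close>, and the iteration yields its square root.\<close>

lemma ex_halmos_defect:
  fixes T :: "'h::complex_hilbert \<Rightarrow> 'h"
  assumes T: "T \<in> quantum_annulus r" and r: "0 < r" "r < 1"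
  defines "X \<equiv> \<lambda>x. cadjoint T (T x)"
  obtains Y where "bounded_clinear Y" "\<And>x y. inner (Y x) y = inner x (Y y)" "\<And>x. Y (X x) = X (Y x)"
    "\<And>x. Y (Y x) = (r\<^sup>2 + (1 / r)\<^sup>2) *\<^sub>R X x - X (X x) - x"
proof -
  note TD = quantum_annulusD[OF T] invertible_opD[OF quantum_annulusD(1)[OF T]]
  \<comment> \<open>\<open>m\<close> is the midpoint and \<open>d\<close> the half-length of the
    interval from \<open>a\<close> to \<open>b\<close>.\<close>
  define a b m d where "a = r\<^sup>2" and "b = (1 / r)\<^sup>2" and "m = (a + b) / 2" and "d = (b - a) / 2"
  have ab: "a * b = 1"
    using r by (simp add: a_def b_def power2_eq_square)
  have "a < 1"
    unfolding a_def using r power_strict_mono[of r 1 2] by simp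
  moreover have "1 < b"
    unfolding b_def using r by (intro one_less_power) auto
  ultimately have d: "0 < d"
    by (simp add: d_def)
  have "m * m - d * d = a * b"
    by (simp add: m_def d_def field_simps)
  then have dd: "d * d = m * m - 1"
    using ab by simp
  have X: "bounded_clinear X"
    unfolding X_def by (rule bounded_clinear_intros(3)[OF bounded_clinear_cadjoint]) (rule TD(4))+
  have X_sym: "inner (X x) y = inner x (X y)" for x y
    by (simp add: X_def flip: inner_cadjoint[OF TD(4)] inner_cadjoint'[OF TD(4)])
  have X_inner: "inner (X x) x = (norm (T x))\<^sup>2" for x
    by (simp add: X_def power2_norm_eq_inner flip: inner_cadjoint'[OF TD(4)])
  define D where "D x = (1 / d) *\<^sub>R (X x - m *\<^sub>R x)" for x
  have D: "bounded_clinear D"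
    unfolding D_def by (intro bounded_clinear_intros(2,5,6) X)
  have D_sym: "inner (D x) y = inner x (D y)" for x y
    by (simp add: D_def inner_diff_left inner_diff_right X_sym)
  have "\<bar>inner (D x) x\<bar> \<le> (norm x)\<^sup>2" for x
  proof -
    have "norm x \<le> 1 / r * norm (T x)"
      using TD(3)[of "T x"] by (simp add: TD)
    then have "r * norm x \<le> norm (T x)"
      using r by (simp add: field_simps)
    then have "(r * norm x)\<^sup>2 \<le> (norm (T x))\<^sup>2"
      by (rule power_mono) (use r in simp)
    then have lower: "a * (norm x)\<^sup>2 \<le> (norm (T x))\<^sup>2"
      by (simp only: power_mult_distrib a_def)
    have "(norm (T x))\<^sup>2 \<le> (1 / r * norm x)\<^sup>2"
      by (rule power_mono[OF TD(2)]) simp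
    then have upper: "(norm (T x))\<^sup>2 \<le> b * (norm x)\<^sup>2"
      by (simp only: power_mult_distrib b_def)
    have "d * inner (D x) x = (norm (T x))\<^sup>2 - m * (norm x)\<^sup>2"
      using d by (simp add: D_def inner_diff_left X_inner power2_norm_eq_inner)
    moreover have "a * (norm x)\<^sup>2 = m * (norm x)\<^sup>2 - d * (norm x)\<^sup>2"
      "b * (norm x)\<^sup>2 = m * (norm x)\<^sup>2 + d * (norm x)\<^sup>2"
      by (simp_all add: m_def d_def field_simps)
    ultimately have 1: "d * inner (D x) x \<le> d * (norm x)\<^sup>2" and 2: "d * (- inner (D x) x) \<le> d * (norm x)\<^sup>2"
      using lower upper by simp_all
    show ?thesis
      using mult_left_le_imp_le[OF 1 d] mult_left_le_imp_le[OF 2 d] by (simp add: abs_le_iff)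
  qed
  then have contr: "norm (D x) \<le> norm x" for x
    by (rule symmetric_contraction[OF D D_sym])
  obtain B where B: "bounded_clinear B" and B2: "\<And>x. 2 *\<^sub>R B x = D (D x) + B (B x)"
    and B_sym: "\<And>x y. inner (B x) y = inner x (B y)"
    and B_comm: "\<forall>C. bounded_clinear C \<and> (\<forall>x. C (D (D x)) = D (D (C x))) \<longrightarrow> (\<forall>x. C (B x) = B (C x))"
  proof (rule ex_one_minus_sqrt[of "\<lambda>x. D (D x)"])
    show "bounded_clinear (\<lambda>x. D (D x))"
      by (rule bounded_clinear_intros(3)[OF D D])
    show "norm (D (D x)) \<le> norm x" for x
      using contr[of "D x"] contr[of x] by linarith
    show "inner (D (D x)) y = inner x (D (D y))" for x y
      by (simp add: D_sym)
  qed (rule that)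
  have "X (D x) = D (X x)" for x
    by (simp add: D_def bounded_clinearD[OF X])
  \<comment> \<open>\<open>X\<close> commutes with \<open>D\<close>, hence with
    \<open>D \<circ> D\<close>, hence with \<open>B\<close>.\<close>
  then have XB: "X (B x) = B (X x)" for x
    using B_comm X by simp
  define Y where "Y x = d *\<^sub>R (x - B x)" for x
  show thesis
  proof (rule that)
    show "bounded_clinear Y"
      unfolding Y_def by (intro bounded_clinear_intros(2,5,6) B)
    show "inner (Y x) y = inner x (Y y)" for x y
      by (simp add: Y_def inner_diff_left inner_diff_right B_sym)
    show "Y (X x) = X (Y x)" for x
      by (simp add: Y_def bounded_clinearD[OF X] XB)
    show "Y (Y x) = (r\<^sup>2 + (1 / r)\<^sup>2) *\<^sub>R X x - X (X x) - x" for x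
    proof -
      have "Y (Y x) = (d * d) *\<^sub>R (x - 2 *\<^sub>R B x + B (B x))"
        by (simp add: Y_def bounded_clinearD[OF B] algebra_simps scaleR_2)
      also have "\<dots> = (d * d) *\<^sub>R x - (d * d) *\<^sub>R D (D x)"
        by (simp add: B2 algebra_simps)
      also have "(d * d) *\<^sub>R D (D x) = X (X x) - (2 * m) *\<^sub>R X x + (m * m) *\<^sub>R x"
        using d by (simp add: D_def bounded_clinearD[OF X] algebra_simps flip: scaleR_2)
      also have "(d * d) *\<^sub>R x - (X (X x) - (2 * m) *\<^sub>R X x + (m * m) *\<^sub>R x) = (2 * m) *\<^sub>R X x - X (X x) - x"
        by (simp add: dd algebra_simps)
      finally show ?thesis
        by (simp add: m_def a_def b_def)
    qed
  qed
qed

lemma quantum_annulus_dilation: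
  fixes T :: "'h::complex_hilbert \<Rightarrow> 'h"
  assumes T: "T \<in> quantum_annulus r" and r: "0 < r" "r < 1"
  shows "\<exists>(J :: 'h \<times> 'h \<Rightarrow> 'h \<times> 'h) (V :: 'h \<Rightarrow> 'h \<times> 'h).
    J \<in> script_quantum_annulus r \<and> dilates_via V T J"
proof -
  note TD = invertible_opD[OF quantum_annulusD(1)[OF T]]
  note T_inv = cadjoint_inverse[OF quantum_annulusD(1)[OF T]]
  define X where "X x = cadjoint T (T x)" for x
  define s where "s = r\<^sup>2 + (1 / r)\<^sup>2"
  obtain Y where Y: "bounded_clinear Y" and Y_sym: "\<And>x y. inner (Y x) y = inner x (Y y)"
    and YX: "\<And>x. Y (X x) = X (Y x)" and YY: "\<And>x. Y (Y x) = s *\<^sub>R X x - X (X x) - x"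
    using ex_halmos_defect[OF T r] unfolding X_def s_def by blast
  define R Ts Ti where "R = cadjoint (inv T)" and "Ts = cadjoint T" and "Ti = inv T"
  have lin: "bounded_clinear T" "bounded_clinear Ti" "bounded_clinear Ts" "bounded_clinear R"
    by (simp_all add: R_def Ts_def Ti_def TD bounded_clinear_cadjoint)
  have cancel: "Ti (T x) = x" "T (Ti x) = x" "Ts (R x) = x" "R (Ts x) = x" for x
    by (simp_all add: R_def Ts_def Ti_def TD T_inv)
  have X: "bounded_clinear X"
    unfolding X_def Ts_def[symmetric] by (rule bounded_clinear_intros(3)[OF lin(3,1)])
  note simps = bounded_clinearD(2-4,6)[OF lin(1)] bounded_clinearD(2-4,6)[OF lin(2)]
    bounded_clinearD(2-4,6)[OF lin(3)] bounded_clinearD(2-4,6)[OF lin(4)]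
    bounded_clinearD(2-4,6)[OF Y] bounded_clinearD(2-4,6)[OF X]
  define J where "J z = (T (fst z) + R (Y (snd z)), R (snd z))" for z
  \<comment> \<open>Back substitution: the second coordinate is recovered first by
    \<open>Ts\<close>, then the corner term is subtracted before applying \<open>Ti\<close>.\<close>
  define K where "K z = (Ti (fst z - R (Y (Ts (snd z)))), Ts (snd z))" for z
  note c = bounded_clinear_prod_intros bounded_clinear_intros(3)
  have J: "bounded_clinear J"
    unfolding J_def
    by (intro c(3) bounded_clinear_intros(4) c(4)[OF lin(1) c(1)] c(4)[OF lin(4) c(4)[OF Y c(2)]]
        c(4)[OF lin(4) c(2)])
  have K: "bounded_clinear K"
    unfolding K_def
    by (intro c(3) c(4)[OF lin(2)] bounded_clinear_intros(5) c(1) c(4)[OF lin(3) c(2)]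
        c(4)[OF lin(4) c(4)[OF Y c(4)[OF lin(3) c(2)]]])
  have "K (J z) = z" "J (K z) = z" for z
    by (simp_all add: J_def K_def cancel simps)
  then have inv_J: "invertible_op J" "inv J = K"
    using invertible_opI[OF J K] by simp_all
  have adj: "cadjoint J = (\<lambda>z. (Ts (fst z), Y (Ti (fst z)) + Ti (snd z)))"
  proof (rule cadjoint_eqI[OF J])
    have R_adj: "inner (R x) y = inner x (Ti y)" for x y
      unfolding R_def Ti_def by (rule inner_cadjoint'[OF TD(2), symmetric])
    have T_adj: "inner (T x) y = inner x (Ts y)" for x y
      unfolding Ts_def by (rule inner_cadjoint[OF TD(1)])
    show "inner (J z) w = inner z (Ts (fst w), Y (Ti (fst w)) + Ti (snd w))" for z w
      by (simp add: J_def inner_prod_def inner_add_left inner_add_right R_adj T_adj Y_sym)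
  qed
  have XTs: "Ts (T x) = X x" for x
    by (simp add: X_def Ts_def)
  \<comment> \<open>\<open>Ti \<circ> R\<close> is the inverse of \<open>X\<close>; it therefore
    commutes with \<open>Y\<close>, and the lower right entry below is this inverse applied to
    \<open>Y (Y y) + y\<close>.\<close>
  have Xi: "Ti (R (X x)) = x" "X (Ti (R x)) = x" for x
    by (simp_all add: X_def cancel flip: Ts_def)
  have "Y (Ti (R x)) = Ti (R (Y x))" for x
    using Xi(1)[of "Y (Ti (R x))"] by (simp add: Xi flip: YX)
  then have lower_right: "Y (Ti (R (Y y))) + Ti (R y) = s *\<^sub>R y - X y" for y
    by (simp add: YY simps Xi)
  have JJ: "cadjoint J (J (x, y)) = (X x + Y y, Y x + (s *\<^sub>R y - X y))" for x y
    by (simp add: adj J_def simps cancel XTs lower_right add.assoc)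
  have "J \<in> script_quantum_annulus r"
  proof (rule script_quantum_annulusI[OF inv_J(1) r])
    fix z :: "'h \<times> 'h"
    obtain x y where z: "z = (x, y)"
      by fastforce
    \<comment> \<open>Block by block: the diagonal entries follow from the formula for
      \<open>Y (Y x)\<close>, the off-diagonal ones from \<open>Y\<close> commuting with
      \<open>X\<close>.\<close>
    show "cadjoint J (J (cadjoint J (J z))) = (r\<^sup>2 + (1 / r)\<^sup>2) *\<^sub>R cadjoint J (J z) - z"
      unfolding z JJ s_def[symmetric] by (simp add: simps YX YY algebra_simps)
  qed
  \<comment> \<open>The space embeds as the first summand, which \<open>J\<close> and
    \<open>K\<close> preserve and on which they act as \<open>T\<close> and
    \<open>Ti\<close>.\<close>
  moreover have "dilates_via (\<lambda>x. (x, 0)) T J"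
    unfolding dilates_via_def
  proof (intro conjI allI)
    have V: "bounded_clinear (\<lambda>x::'h. (x, 0::'h))"
      by (rule c(3)[OF bounded_clinear_intros(2) bounded_clinear_zero])
    then show "isometry_op (\<lambda>x::'h. (x, 0::'h))"
      by (simp add: isometry_op_def norm_Pair)
    have "cadjoint (\<lambda>x::'h. (x, 0::'h)) = fst"
      by (rule cadjoint_eqI[OF V]) (simp add: inner_prod_def)
    moreover have "op_powi J n (x, 0) = (op_powi T n x, 0)" for n x
      by (rule op_powi_fst_invariant) (simp_all add: inv_J(2) J_def K_def simps Ti_def)
    ultimately show "op_powi T n = cadjoint (\<lambda>x. (x, 0)) \<circ> op_powi J n \<circ> (\<lambda>x. (x, 0))" for n
      by (simp add: fun_eq_iff)
  qed (fact quantum_annulusD(1)[OF T] inv_J(1))+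
  ultimately show ?thesis
    by blast
qed

theorem theorem1p1:
  fixes r :: real
  assumes "0 < r" and "r < 1"
  shows
    "(\<forall>J :: 'h::complex_hilbert \<Rightarrow> 'h. J \<in> script_quantum_annulus r \<longrightarrow>
        J \<in> quantum_annulus r \<and> dilation_extremal TYPE('k::complex_hilbert) r J) \<and>
     (\<forall>(J :: 'h \<Rightarrow> 'h) (\<pi> :: ('h \<Rightarrow> 'h) \<Rightarrow> ('g::complex_hilbert \<Rightarrow> 'g)).
        J \<in> script_quantum_annulus r \<and> unital_star_rep \<pi> \<longrightarrow>
        \<pi> J \<in> script_quantum_annulus r) \<and>
     (\<forall>T :: 'h \<Rightarrow> 'h. T \<in> quantum_annulus r \<longrightarrow>
        (\<exists>(J :: 'h \<times> 'h \<Rightarrow> 'h \<times> 'h) (V :: 'h \<Rightarrow> 'h \<times> 'h).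
           J \<in> script_quantum_annulus r \<and> dilates_via V T J))"
  using script_quantum_annulus_subset[OF _ assms] script_quantum_annulus_extremal[OF _ assms]
    script_quantum_annulus_star_rep quantum_annulus_dilation[OF _ assms]
  by blast

end
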